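(* Let $f(t)=t^\top\widetilde Gt+2w^\top t$ for $t\in\mathbb{R}^{nM}$. There exists a global minimizer $t^*$ of the problem (RSQP) $$\min_{t\in\mathbb{R}^{nM}} f(t)\quad\text{s.t. } \boldsymbol{e}^\top\bar t_j=1,\ j=1,\ldots,n,\quad t\geqslant 0,$$ such that $\|t^*\|_0=n$. As a result, $t^*$ is a global minimizer of the problem (SQP2) $$\min_{t\in\mathbb{R}^{nM}} f(t)\quad\text{s.t. } \boldsymbol{e}^\top\bar t_j=1,\ j=1,\ldots,n,\quad t\geqslant 0,\quad \|t\|_0\leqslant n.$$
   Context: $m,n\geqslant1$ and $M\geqslant 2$ are integers, $H\in\mathbb{C}^{m\times n}$, $r\in\mathbb{C}^m$; $(\cdot)^\dagger$ is the conjugate transpose. $Q=H^\dagger H$, $c=-H^\dagger r$. $\widehat Q=\begin{bmatrix}\mathrm{Re}(Q)&-\mathrm{Im}(Q)\\ \mathrm{Im}(Q)&\mathrm{Re}(Q)\end{bmatrix}\in\mathbb{R}^{2n\times 2n}$, $\hat c=\begin{bmatrix}\mathrm{Re}(c)\\ \mathrm{Im}(c)\end{bmatrix}\in\mathbb{R}^{2n}$. $\theta_k=2(k-1)\pi/M$ for $k=1,\ldots,M$; $\alpha=(\cos\theta_1,\ldots,\cos\theta_M)^\top$, $\beta=(\sin\theta_1,\ldots,\sin\theta_M)^\top\in\mathbb{R}^M$. $A=I\otimes\alpha^\top$, $B=I\otimes\beta^\top\in\mathbb{R}^{n\times nM}$ ($I$ the $n\times n$ identity, $\otimes$ the Kronecker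 product), $P=\begin{bmatrix}A\\ B\end{bmatrix}\in\mathbb{R}^{2n\times nM}$, $G=P^\top\widehat QP\in\mathbb{R}^{nM\times nM}$, $w=P^\top\hat c\in\mathbb{R}^{nM}$. $G$ is partitioned into $n\times n$ blocks $S_{jk}\in\mathbb{R}^{M\times M}$; $\widetilde D=\mathrm{Diag}(S_{11},\ldots,S_{nn})$ is the block-diagonal matrix of the diagonal blocks, and $\widetilde G=G-\widetilde D$. A vector $t\in\mathbb{R}^{nM}$ is partitioned as $t=(\bar t_1^\top,\ldots,\bar t_n^\top)^\top$ with blocks $\bar t_j\in\mathbb{R}^M$. $\boldsymbol{e}$ is the all-ones vector, $\|t\|_0$ is the number of nonzero entries of $t$, and $t\geqslant0$ is entrywise. *)

theory Defs
  imports "Jordan_Normal_Form.Schur_Decomposition"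
begin

text \<open>
  Matrices and vectors are those of Jordan_Normal_Form, with entries indexed from 0.
  So block \<open>j\<close> of a vector of dimension \<open>n * M\<close> occupies the entries
  \<open>j * M, \<dots>, j * M + M - 1\<close> (for \<open>j < n\<close>).
\<close>

definition kronecker_mat :: "'a::times mat \<Rightarrow> 'a mat \<Rightarrow> 'a mat" where
  "kronecker_mat A B =
     mat (dim_row A * dim_row B) (dim_col A * dim_col B)
       (\<lambda>(i, j). A $$ (i div dim_row B, j div dim_col B) * B $$ (i mod dim_row B, j mod dim_col B))"

definition l0_norm :: "'a::zero vec \<Rightarrow> nat" where
  "l0_norm t = card {i. i < dim_vec t \<and> t $ i \<noteq> 0}"

definition vec_block :: "nat \<Rightarrow> 'a vec \<Rightarrow> nat \<Rightarrow> 'a vec" where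
  "vec_block M t j = vec M (\<lambda>a. t $ (j * M + a))"

definition mat_block :: "nat \<Rightarrow> 'a mat \<Rightarrow> nat \<Rightarrow> nat \<Rightarrow> 'a mat" where
  "mat_block M S j k = mat M M (\<lambda>(a, b). S $$ (j * M + a, k * M + b))"

definition ones_vec :: "nat \<Rightarrow> real vec" where
  "ones_vec N = vec N (\<lambda>_. 1)"

definition Q_mat :: "complex mat \<Rightarrow> complex mat" where
  "Q_mat H = mat_adjoint H * H"

definition c_vec :: "complex mat \<Rightarrow> complex vec \<Rightarrow> complex vec" where
  "c_vec H r = - (mat_adjoint H *\<^sub>v r)"

definition Q_hat :: "complex mat \<Rightarrow> real mat" where
  "Q_hat H =
     four_block_mat (map_mat Re (Q_mat H)) (- map_mat Im (Q_mat H))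
                    (map_mat Im (Q_mat H)) (map_mat Re (Q_mat H))"

definition c_hat :: "complex mat \<Rightarrow> complex vec \<Rightarrow> real vec" where
  "c_hat H r = map_vec Re (c_vec H r) @\<^sub>v map_vec Im (c_vec H r)"

text \<open>The angle \<open>theta M k\<close> is meant for \<open>1 \<le> k \<le> M\<close>.\<close>

definition theta :: "nat \<Rightarrow> nat \<Rightarrow> real" where
  "theta M k = 2 * (real k - 1) * pi / real M"

definition alpha_vec :: "nat \<Rightarrow> real vec" where
  "alpha_vec M = vec M (\<lambda>k. cos (theta M (k + 1)))"

definition beta_vec :: "nat \<Rightarrow> real vec" where
  "beta_vec M = vec M (\<lambda>k. sin (theta M (k + 1)))"

definition A_mat :: "nat \<Rightarrow> nat \<Rightarrow> real mat" where
  "A_mat n M = kronecker_mat (1\<^sub>m n) (mat_of_row (alpha_vec M))"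

definition B_mat :: "nat \<Rightarrow> nat \<Rightarrow> real mat" where
  "B_mat n M = kronecker_mat (1\<^sub>m n) (mat_of_row (beta_vec M))"

definition P_mat :: "nat \<Rightarrow> nat \<Rightarrow> real mat" where
  "P_mat n M = A_mat n M @\<^sub>r B_mat n M"

definition G_mat :: "nat \<Rightarrow> complex mat \<Rightarrow> real mat" where
  "G_mat M H = (let P = P_mat (dim_col H) M in transpose_mat P * Q_hat H * P)"

definition w_vec :: "nat \<Rightarrow> complex mat \<Rightarrow> complex vec \<Rightarrow> real vec" where
  "w_vec M H r = transpose_mat (P_mat (dim_col H) M) *\<^sub>v c_hat H r"

definition D_tilde :: "nat \<Rightarrow> complex mat \<Rightarrow> real mat" where
  "D_tilde M H = diag_block_mat (map (\<lambda>j. mat_block M (G_mat M H) j j) [0..<dim_col H])"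

definition G_tilde :: "nat \<Rightarrow> complex mat \<Rightarrow> real mat" where
  "G_tilde M H = G_mat M H - D_tilde M H"

definition objective :: "nat \<Rightarrow> complex mat \<Rightarrow> complex vec \<Rightarrow> real vec \<Rightarrow> real" where
  "objective M H r t = t \<bullet> (G_tilde M H *\<^sub>v t) + 2 * (w_vec M H r \<bullet> t)"

definition RSQP_feasible :: "nat \<Rightarrow> nat \<Rightarrow> real vec \<Rightarrow> bool" where
  "RSQP_feasible n M t \<longleftrightarrow>
     t \<in> carrier_vec (n * M) \<and> (\<forall>j<n. ones_vec M \<bullet> vec_block M t j = 1) \<and> 0\<^sub>v (n * M) \<le> t"

definition SQP2_feasible :: "nat \<Rightarrow> nat \<Rightarrow> real vec \<Rightarrow> bool" where
  "SQP2_feasible n M t \<longleftrightarrow> RSQP_feasible n M t \<and> l0_norm t \<le> n"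

end

theory Submission
  imports Defs
begin

text \<open>
  The diagonal blocks of \<open>G_tilde\<close> vanish, so \<open>f\<close> is affine in each block while the other blocks
  are held fixed. Hence the value at a feasible point is a convex combination of the values obtained
  by replacing one block by the unit vectors, and some replacement does not increase \<open>f\<close>. Treating
  the blocks one after the other turns every feasible point into one of the \<open>M ^ n\<close> vertices without
  increasing \<open>f\<close>; a best vertex is therefore a global minimizer.
\<close>

section \<open>Quadratic functions that are affine in each block\<close>

text \<open>Points are functions on \<open>nat\<close>, read only below \<open>N\<close>. This keeps
  the block argument free of matrices and carriers.\<close>

definition quad_fun :: "nat \<Rightarrow> (nat \<Rightarrow> nat \<Rightarrow> real) \<Rightarrow> (nat \<Rightarrow> real) \<Rightarrow> (nat \<Rightarrow> real) \<Rightarrow> real" where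
  "quad_fun N g v x = (\<Sum>i<N. \<Sum>k<N. g i k * (x i * x k)) + (\<Sum>i<N. v i * x i)"

text \<open>The product of \<open>n\<close> standard simplices. Coordinates from
  \<open>n * M\<close> on are unconstrained, so \<open>(\<lambda>i. t $ i)\<close> may belong to it
  whatever \<open>t $ i\<close> is beyond the dimension of \<open>t\<close>.\<close>

definition simplex_product :: "nat \<Rightarrow> nat \<Rightarrow> (nat \<Rightarrow> real) set" where
  "simplex_product n M =
     {x. (\<forall>i < n * M. 0 \<le> x i) \<and> (\<forall>j<n. (\<Sum>a<M. x (j * M + a)) = 1)}"

definition block_unit :: "nat \<Rightarrow> nat \<Rightarrow> nat \<Rightarrow> (nat \<Rightarrow> real) \<Rightarrow> nat \<Rightarrow> real" where
  "block_unit M j a x = (\<lambda>i. if i div M = j then of_bool (i mod M = a) else x i)"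

text \<open>An extreme point of the product of simplices: \<open>\<sigma> j\<close> is the position
  of the single 1 in block \<open>j\<close>.\<close>

definition vertex :: "nat \<Rightarrow> (nat \<Rightarrow> nat) \<Rightarrow> nat \<Rightarrow> real" where
  "vertex M \<sigma> i = of_bool (i mod M = \<sigma> (i div M))"

lemma quad_fun_cong:
  assumes "\<And>i. i < N \<Longrightarrow> x i = y i"
  shows "quad_fun N g v x = quad_fun N g v y"
  using assms by (simp add: quad_fun_def)

lemma block_index_less:
  fixes j a n M :: nat
  assumes "j < n" "a < M"
  shows "j * M + a < n * M"
proof -
  have "j * M + a < Suc j * M" using assms by simp
  also have "\<dots> \<le> n * M" using assms by (intro mult_le_mono1) simp
  finally show ?thesis .
qed

lemma block_unit_in_simplex_product:
  assumes "x \<in> simplex_product n M" "a < M"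
  shows "block_unit M j a x \<in> simplex_product n M"
proof -
  have "(\<Sum>b<M. block_unit M j a x (k * M + b)) = 1" if "k < n" for k
  proof (cases "k = j")
    case True
    have "(\<Sum>b<M. block_unit M j a x (k * M + b)) = (\<Sum>b<M. if b = a then 1 else 0)"
      using True by (intro sum.cong) (auto simp: block_unit_def)
    then show ?thesis using assms(2) by simp
  next
    case False
    have "(\<Sum>b<M. block_unit M j a x (k * M + b)) = (\<Sum>b<M. x (k * M + b))"
      using False by (intro sum.cong) (auto simp: block_unit_def)
    then show ?thesis using assms(1) that by (simp add: simplex_product_def)
  qed
  then show ?thesis
    using assms(1) by (simp add: simplex_product_def block_unit_def)
qed

text \<open>Block \<open>j\<close> of \<open>x\<close> is the combination of the unit vectors with
  its own entries as weights; the other blocks stay fixed, and the weights sum to 1.\<close>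

lemma sum_block_unit:
  assumes "x \<in> simplex_product n M" "j < n" "0 < M"
  shows "(\<Sum>a<M. x (j * M + a) * block_unit M j a x i) = x i"
proof (cases "i div M = j")
  case True
  have "(\<Sum>a<M. x (j * M + a) * block_unit M j a x i)
      = (\<Sum>a<M. if a = i mod M then x (j * M + a) else 0)"
    using True by (intro sum.cong) (auto simp: block_unit_def)
  also have "\<dots> = x (j * M + i mod M)" using assms(3) by simp
  also have "\<dots> = x i" using True by (metis div_mult_mod_eq)
  finally show ?thesis .
next
  case False
  then have "(\<Sum>a<M. x (j * M + a) * block_unit M j a x i) = (\<Sum>a<M. x (j * M + a)) * x i"
    by (simp add: block_unit_def sum_distrib_right)
  then show ?thesis using assms by (simp add: simplex_product_def)
qed

text \<open>Of two indices in different blocks at most one lies in block \<open>j\<close>. The other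
  factor does not depend on \<open>a\<close> and leaves the sum, so the linear case applies.\<close>

lemma sum_block_unit_mult:
  assumes "x \<in> simplex_product n M" "j < n" "0 < M" "i div M \<noteq> k div M"
  shows "(\<Sum>a<M. x (j * M + a) * (block_unit M j a x i * block_unit M j a x k)) = x i * x k"
proof -
  have *: "(\<Sum>a<M. x (j * M + a) * (block_unit M j a x p * block_unit M j a x q)) = x p * x q"
    if "q div M \<noteq> j" for p q
  proof -
    have "(\<Sum>a<M. x (j * M + a) * (block_unit M j a x p * block_unit M j a x q))
        = (\<Sum>a<M. x (j * M + a) * block_unit M j a x p) * x q"
      using that by (simp add: block_unit_def sum_distrib_right mult.assoc)
    then show ?thesis using sum_block_unit[OF assms(1-3)] by simp
  qed
  show ?thesis
  proof (cases "k div M = j")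
    case True
    then show ?thesis using *[where p = k and q = i] assms(4)
      by (simp add: mult.commute)
  next
    case False
    then show ?thesis by (rule *)
  qed
qed

text \<open>This is affinity in block \<open>j\<close>: products within one block have coefficient
  0, and all other products and the linear terms average to their values at
  \<open>x\<close>.\<close>

lemma quad_fun_block_average:
  assumes x: "x \<in> simplex_product n M" "j < n" "0 < M"
    and g: "\<And>i k. i < N \<Longrightarrow> k < N \<Longrightarrow> i div M = k div M \<Longrightarrow> g i k = 0"
  shows "(\<Sum>a<M. x (j * M + a) * quad_fun N g v (block_unit M j a x)) = quad_fun N g v x"
proof -
  let ?c = "\<lambda>a. x (j * M + a)" and ?y = "\<lambda>a. block_unit M j a x"
  have "(\<Sum>a<M. ?c a * (\<Sum>i<N. \<Sum>k<N. g i k * (?y a i * ?y a k)))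
      = (\<Sum>i<N. \<Sum>a<M. \<Sum>k<N. ?c a * (g i k * (?y a i * ?y a k)))"
    unfolding sum_distrib_left by (rule sum.swap)
  also have "\<dots> = (\<Sum>i<N. \<Sum>k<N. \<Sum>a<M. ?c a * (g i k * (?y a i * ?y a k)))"
    by (intro sum.cong refl sum.swap)
  also have "\<dots> = (\<Sum>i<N. \<Sum>k<N. g i k * (\<Sum>a<M. ?c a * (?y a i * ?y a k)))"
    by (simp add: sum_distrib_left mult.left_commute)
  also have "\<dots> = (\<Sum>i<N. \<Sum>k<N. g i k * (x i * x k))"
  proof (intro sum.cong refl)
    fix i k assume "i \<in> {..<N}" "k \<in> {..<N}"
    then show "g i k * (\<Sum>a<M. ?c a * (?y a i * ?y a k)) = g i k * (x i * x k)"
      using g sum_block_unit_mult[OF x, of i k] by (cases "i div M = k div M") auto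
  qed
  finally have quadratic: "(\<Sum>a<M. ?c a * (\<Sum>i<N. \<Sum>k<N. g i k * (?y a i * ?y a k)))
      = (\<Sum>i<N. \<Sum>k<N. g i k * (x i * x k))" .
  have "(\<Sum>a<M. ?c a * (\<Sum>i<N. v i * ?y a i)) = (\<Sum>i<N. \<Sum>a<M. ?c a * (v i * ?y a i))"
    unfolding sum_distrib_left by (rule sum.swap)
  also have "\<dots> = (\<Sum>i<N. v i * (\<Sum>a<M. ?c a * ?y a i))"
    by (simp add: sum_distrib_left mult.left_commute)
  also have "\<dots> = (\<Sum>i<N. v i * x i)"
    by (simp add: sum_block_unit[OF x])
  finally show ?thesis
    using quadratic by (simp add: quad_fun_def distrib_left sum.distrib)
qed

lemma convex_combination_attains_le:
  fixes c f :: "'a \<Rightarrow> real"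
  assumes "sum c A = 1" "\<And>a. a \<in> A \<Longrightarrow> 0 \<le> c a"
  shows "\<exists>a\<in>A. f a \<le> (\<Sum>a\<in>A. c a * f a)"
proof (rule ccontr)
  let ?s = "\<Sum>a\<in>A. c a * f a"
  assume "\<not> ?thesis"
  then have less: "?s < f a" if "a \<in> A" for a using that by force
  have "(\<Sum>a\<in>A. c a * (f a - ?s)) = 0"
    using assms(1) by (simp add: right_diff_distrib sum_subtractf flip: sum_distrib_right)
  \<comment> \<open>A sum over an infinite set is 0 by convention, so total weight 1 forces
    finiteness.\<close>
  moreover have fin: "finite A" using assms(1) by (metis sum.infinite zero_neq_one)
  moreover have "0 \<le> c a * (f a - ?s)" if "a \<in> A" for a
    using less[OF that] assms(2)[OF that] by simp
  ultimately have "\<forall>a\<in>A. c a * (f a - ?s) = 0"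
    by (simp add: sum_nonneg_eq_0_iff)
  then have "\<forall>a\<in>A. c a = 0" using less by force
  then show False using assms(1) by simp
qed

lemma quad_fun_vertex_le:
  assumes x: "x \<in> simplex_product n M" and M: "0 < M"
    and g: "\<And>i k. i < n * M \<Longrightarrow> k < n * M \<Longrightarrow> i div M = k div M \<Longrightarrow> g i k = 0"
  shows "\<exists>\<sigma>\<in>{..<n} \<rightarrow>\<^sub>E {..<M}. quad_fun (n * M) g v (vertex M \<sigma>) \<le> quad_fun (n * M) g v x"
proof -
  let ?f = "quad_fun (n * M) g v"
  \<comment> \<open>Invariant of the rounding: the first \<open>p\<close> blocks of \<open>y\<close>
    are already unit vectors, \<open>y\<close> is still in the product of simplices, and the value
    has not grown.\<close>
  have "\<exists>y \<sigma>. y \<in> simplex_product n M \<and> \<sigma> \<in> {..<p} \<rightarrow>\<^sub>E {..<M} \<and> ?f y \<le> ?f x \<and>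
      (\<forall>i. i div M < p \<longrightarrow> y i = vertex M \<sigma> i)" if "p \<le> n" for p
    using that
  proof (induction p)
    case 0
    then show ?case using x by (intro exI[of _ x]) simp
  next
    case (Suc p)
    then obtain y \<sigma> where y: "y \<in> simplex_product n M" "\<sigma> \<in> {..<p} \<rightarrow>\<^sub>E {..<M}" "?f y \<le> ?f x"
      "\<And>i. i div M < p \<Longrightarrow> y i = vertex M \<sigma> i" by auto
    have p: "p < n" using Suc.prems by simp
    \<comment> \<open>The weights are the entries of block \<open>p\<close> of \<open>y\<close>; the
      average on the right equals \<open>?f y\<close>.\<close>
    have "\<exists>a\<in>{..<M}. ?f (block_unit M p a y) \<le> (\<Sum>a<M. y (p * M + a) * ?f (block_unit M p a y))"
      using y(1) p
      by (intro convex_combination_attains_le) (auto simp: simplex_product_def block_index_less)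
    then obtain a where a: "a < M" "?f (block_unit M p a y) \<le> ?f y"
      using quad_fun_block_average[OF y(1) p M g] by auto
    show ?case
    proof (intro exI conjI)
      show "block_unit M p a y \<in> simplex_product n M"
        using y(1) a(1) by (rule block_unit_in_simplex_product)
      show "\<sigma>(p := a) \<in> {..<Suc p} \<rightarrow>\<^sub>E {..<M}"
        using y(2) a(1) by (auto simp: PiE_iff extensional_def less_Suc_eq)
      show "?f (block_unit M p a y) \<le> ?f x" using a(2) y(3) by simp
      show "\<forall>i. i div M < Suc p \<longrightarrow> block_unit M p a y i = vertex M (\<sigma>(p := a)) i"
        using y(4) by (auto simp: block_unit_def vertex_def less_Suc_eq)
    qed
  qed
  then obtain y \<sigma> where y: "\<sigma> \<in> {..<n} \<rightarrow>\<^sub>E {..<M}" "?f y \<le> ?f x"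
      "\<And>i. i div M < n \<Longrightarrow> y i = vertex M \<sigma> i" by blast
  \<comment> \<open>The two points need agree only below \<open>n * M\<close>, which is all that
    \<open>?f\<close> reads.\<close>
  have "?f y = ?f (vertex M \<sigma>)"
    using y(3) by (intro quad_fun_cong) (simp add: less_mult_imp_div_less)
  then show ?thesis using y by auto
qed

text \<open>Choices \<open>\<sigma>\<close> are taken extensional so that there are finitely many of
  them; a best one then beats every point, since each point is dominated by some vertex.\<close>

lemma quad_fun_minimal_vertex:
  assumes "0 < M"
    and "\<And>i k. i < n * M \<Longrightarrow> k < n * M \<Longrightarrow> i div M = k div M \<Longrightarrow> g i k = 0"
  shows "\<exists>\<sigma>\<in>{..<n} \<rightarrow>\<^sub>E {..<M}. \<forall>x\<in>simplex_product n M.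
           quad_fun (n * M) g v (vertex M \<sigma>) \<le> quad_fun (n * M) g v x"
proof -
  let ?S = "{..<n} \<rightarrow>\<^sub>E {..<M}" and ?f = "quad_fun (n * M) g v"
  have "finite ?S" by (intro finite_PiE) auto
  moreover have "?S \<noteq> {}" using assms(1) by (auto simp: PiE_eq_empty_iff)
  ultimately obtain \<sigma> where \<sigma>: "\<sigma> \<in> ?S" "\<And>\<tau>. \<tau> \<in> ?S \<Longrightarrow> ?f (vertex M \<sigma>) \<le> ?f (vertex M \<tau>)"
    using ex_is_arg_min_if_finite[of ?S "\<lambda>\<sigma>. ?f (vertex M \<sigma>)"]
    by (auto simp: is_arg_min_linorder)
  show ?thesis
  proof (intro bexI ballI)
    fix x assume x: "x \<in> simplex_product n M"
    show "?f (vertex M \<sigma>) \<le> ?f x"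
      using quad_fun_vertex_le[OF x assms, where v = v] \<sigma>(2) by force
  qed (rule \<sigma>(1))
qed

lemma vertex_in_simplex_product:
  assumes "\<sigma> \<in> {..<n} \<rightarrow> {..<M}"
  shows "vertex M \<sigma> \<in> simplex_product n M"
proof -
  have "(\<Sum>a<M. vertex M \<sigma> (j * M + a)) = 1" if "j < n" for j
  proof -
    have "(\<Sum>a<M. vertex M \<sigma> (j * M + a)) = (\<Sum>a<M. if a = \<sigma> j then 1 else 0)"
      by (intro sum.cong) (auto simp: vertex_def)
    then show ?thesis using assms that by auto
  qed
  then show ?thesis by (simp add: simplex_product_def vertex_def)
qed

text \<open>Each block contributes exactly one nonzero entry: \<open>j\<close> corresponds to the
  index \<open>j * M + \<sigma> j\<close>, with inverse \<open>i div M\<close>.\<close>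

lemma l0_norm_vertex:
  assumes "\<sigma> \<in> {..<n} \<rightarrow> {..<M}"
  shows "l0_norm (vec (n * M) (vertex M \<sigma>)) = n"
proof -
  have \<sigma>: "\<sigma> j < M" if "j < n" for j using assms that by auto
  have div: "(j * M + \<sigma> j) div M = j" if "j < n" for j using \<sigma>[OF that] by auto
  have "{i. i < n * M \<and> i mod M = \<sigma> (i div M)} = (\<lambda>j. j * M + \<sigma> j) ` {..<n}"
  proof (intro equalityI subsetI)
    fix i assume i: "i \<in> {i. i < n * M \<and> i mod M = \<sigma> (i div M)}"
    then have "i = i div M * M + \<sigma> (i div M)" by (metis (mono_tags) div_mult_mod_eq mem_Collect_eq)
    moreover have "i div M < n" using i by (simp add: less_mult_imp_div_less)
    ultimately show "i \<in> (\<lambda>j. j * M + \<sigma> j) ` {..<n}" by blast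
  qed (use \<sigma> div in \<open>auto simp: block_index_less\<close>)
  moreover have "inj_on (\<lambda>j. j * M + \<sigma> j) {..<n}"
    using div by (intro inj_on_inverseI[where g = "\<lambda>i. i div M"]) simp
  ultimately have "card {i. i < n * M \<and> i mod M = \<sigma> (i div M)} = n"
    by (simp add: card_image)
  moreover have "{i. i < dim_vec (vec (n * M) (vertex M \<sigma>)) \<and> vec (n * M) (vertex M \<sigma>) $ i \<noteq> 0}
      = {i. i < n * M \<and> i mod M = \<sigma> (i div M)}"
    by (auto simp: vertex_def)
  ultimately show ?thesis by (simp add: l0_norm_def)
qed

section \<open>The objective of the relaxed problem\<close>

text \<open>Both claims go through one induction on the list, because reading an entry requires the
  dimensions of the tail. Only entries inside the diagonal blocks are described.\<close>

lemma diag_block_mat_uniform: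
  assumes "\<And>S. S \<in> set Ss \<Longrightarrow> S \<in> carrier_mat M M"
  shows "diag_block_mat Ss \<in> carrier_mat (length Ss * M) (length Ss * M)"
    and "i < length Ss * M \<Longrightarrow> k < length Ss * M \<Longrightarrow> i div M = k div M \<Longrightarrow>
           diag_block_mat Ss $$ (i, k) = (Ss ! (i div M)) $$ (i mod M, k mod M)"
proof -
  have "diag_block_mat Ss \<in> carrier_mat (length Ss * M) (length Ss * M) \<and>
     (\<forall>i k. i < length Ss * M \<longrightarrow> k < length Ss * M \<longrightarrow> i div M = k div M \<longrightarrow>
           diag_block_mat Ss $$ (i, k) = (Ss ! (i div M)) $$ (i mod M, k mod M))"
    using assms
  proof (induction Ss)
    case Nil
    then show ?case by simp
  next
    case (Cons S Ss)
    let ?D = "diag_block_mat Ss"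
    have S: "S \<in> carrier_mat M M" using Cons.prems by simp
    have D: "?D \<in> carrier_mat (length Ss * M) (length Ss * M)"
      and IH: "\<And>i k. i < length Ss * M \<Longrightarrow> k < length Ss * M \<Longrightarrow> i div M = k div M \<Longrightarrow>
           ?D $$ (i, k) = (Ss ! (i div M)) $$ (i mod M, k mod M)"
      using Cons by auto
    have "diag_block_mat (S # Ss) \<in> carrier_mat (length (S # Ss) * M) (length (S # Ss) * M)"
      using S D by (auto simp: Let_def)
    moreover have "diag_block_mat (S # Ss) $$ (i, k)
        = ((S # Ss) ! (i div M)) $$ (i mod M, k mod M)"
      if ik: "i < length (S # Ss) * M" "k < length (S # Ss) * M" "i div M = k div M" for i k
    proof -
      have M: "0 < M" using ik(1) by (cases M) auto
      \<comment> \<open>Indices of the same block lie both in the head block or both in the tail, so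
        the zero off-diagonal parts are never read.\<close>
      have block: "i < M \<longleftrightarrow> k < M" using ik(3) M by (metis div_eq_0_iff neq0_conv)
      show ?thesis
      proof (cases "i < M")
        case True
        then show ?thesis using S D block ik by (simp add: Let_def)
      next
        case False
        then have "i div M = Suc ((i - M) div M)" "k div M = Suc ((k - M) div M)"
          "i mod M = (i - M) mod M" "k mod M = (k - M) mod M"
          using M block by (simp_all add: le_div_geq le_mod_geq)
        moreover have "?D $$ (i - M, k - M) = (Ss ! ((i - M) div M)) $$ ((i - M) mod M, (k - M) mod M)"
          using calculation ik False block by (intro IH) auto
        ultimately show ?thesis using S D block ik False by (simp add: Let_def)
      qed
    qed
    ultimately show ?case by blast
  qed
  then show "diag_block_mat Ss \<in> carrier_mat (length Ss * M) (length Ss * M)"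
    and "i < length Ss * M \<Longrightarrow> k < length Ss * M \<Longrightarrow> i div M = k div M \<Longrightarrow>
           diag_block_mat Ss $$ (i, k) = (Ss ! (i div M)) $$ (i mod M, k mod M)"
    by blast+
qed

lemma P_mat_carrier: "P_mat n M \<in> carrier_mat (n + n) (n * M)"
  unfolding P_mat_def A_mat_def B_mat_def
  by (rule carrier_append_rows) (auto simp: kronecker_mat_def alpha_vec_def beta_vec_def)

lemma G_mat_carrier: "G_mat M H \<in> carrier_mat (dim_col H * M) (dim_col H * M)"
  using carrier_matD[OF P_mat_carrier[of "dim_col H" M]]
  by (intro carrier_matI) (simp_all add: G_mat_def Let_def)

lemma w_vec_carrier: "w_vec M H r \<in> carrier_vec (dim_col H * M)"
  using carrier_matD[OF P_mat_carrier[of "dim_col H" M]]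
  by (intro carrier_vecI) (simp add: w_vec_def)

lemma D_tilde_carrier: "D_tilde M H \<in> carrier_mat (dim_col H * M) (dim_col H * M)"
proof -
  have "D_tilde M H \<in> carrier_mat (length (map (\<lambda>j. mat_block M (G_mat M H) j j) [0..<dim_col H]) * M)
      (length (map (\<lambda>j. mat_block M (G_mat M H) j j) [0..<dim_col H]) * M)"
    unfolding D_tilde_def by (rule diag_block_mat_uniform(1)) (auto simp: mat_block_def)
  then show ?thesis by simp
qed

lemma D_tilde_index:
  assumes "i < dim_col H * M" "k < dim_col H * M" "i div M = k div M"
  shows "D_tilde M H $$ (i, k) = G_mat M H $$ (i, k)"
proof -
  have M: "0 < M" using assms(1) by (cases M) auto
  have "D_tilde M H $$ (i, k)
      = mat_block M (G_mat M H) (i div M) (i div M) $$ (i mod M, k mod M)"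
    unfolding D_tilde_def using assms
    by (subst diag_block_mat_uniform(2)[where M = M])
      (auto simp: mat_block_def less_mult_imp_div_less)
  also have "\<dots> = G_mat M H $$ (i div M * M + i mod M, k div M * M + k mod M)"
    using M assms(3) by (simp add: mat_block_def)
  finally show ?thesis by simp
qed

lemma G_tilde_carrier: "G_tilde M H \<in> carrier_mat (dim_col H * M) (dim_col H * M)"
  using D_tilde_carrier[of M H] by (auto simp: G_tilde_def)

text \<open>Subtracting \<open>D_tilde\<close> cancels the diagonal blocks; this supplies the
  hypothesis on \<open>g\<close> for the block argument.\<close>

lemma G_tilde_diag_block_eq_0:
  assumes "i < dim_col H * M" "k < dim_col H * M" "i div M = k div M"
  shows "G_tilde M H $$ (i, k) = 0"
  using assms D_tilde_carrier[of M H] by (simp add: G_tilde_def D_tilde_index)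

text \<open>Passage from matrices to coordinates; the factor 2 of the linear term is absorbed into
  the coefficients \<open>v\<close>.\<close>

lemma objective_eq_quad_fun:
  assumes "t \<in> carrier_vec (dim_col H * M)"
  shows "objective M H r t = quad_fun (dim_col H * M) (\<lambda>i k. G_tilde M H $$ (i, k))
           (\<lambda>i. 2 * w_vec M H r $ i) (\<lambda>i. t $ i)"
  using assms G_tilde_carrier[of M H] w_vec_carrier[of M H r]
  by (auto simp: objective_def quad_fun_def scalar_prod_def sum_distrib_left lessThan_atLeast0
      mult_ac intro!: sum.cong arg_cong2[of _ _ _ _ "(+)"])

lemma RSQP_feasible_iff:
  "RSQP_feasible n M t \<longleftrightarrow> t \<in> carrier_vec (n * M) \<and> (\<lambda>i. t $ i) \<in> simplex_product n M"
  by (auto simp: RSQP_feasible_def simplex_product_def less_eq_vec_def scalar_prod_def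
      ones_vec_def vec_block_def lessThan_atLeast0)

theorem theorem3p1:
  fixes m n M :: nat and H :: "complex mat" and r :: "complex vec"
  assumes "m \<ge> 1" and "n \<ge> 1" and "M \<ge> 2"
    and "H \<in> carrier_mat m n" and "r \<in> carrier_vec m"
  shows "\<exists>t. is_arg_min (objective M H r) (RSQP_feasible n M) t \<and> l0_norm t = n
           \<and> is_arg_min (objective M H r) (SQP2_feasible n M) t"
proof -
  let ?f = "quad_fun (n * M) (\<lambda>i k. G_tilde M H $$ (i, k)) (\<lambda>i. 2 * w_vec M H r $ i)"
  have n: "dim_col H = n" using assms by simp
  have M: "0 < M" using assms by simp
  obtain \<sigma> where \<sigma>: "\<sigma> \<in> {..<n} \<rightarrow>\<^sub>E {..<M}"
    and min: "\<And>x. x \<in> simplex_product n M \<Longrightarrow> ?f (vertex M \<sigma>) \<le> ?f x"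
    using quad_fun_minimal_vertex[OF M, of n "\<lambda>i k. G_tilde M H $$ (i, k)"
        "\<lambda>i. 2 * w_vec M H r $ i"] G_tilde_diag_block_eq_0[of _ H M] n by blast
  have \<sigma>': "\<sigma> \<in> {..<n} \<rightarrow> {..<M}" using \<sigma> by (simp add: PiE_iff Pi_iff)
  define t where "t = vec (n * M) (vertex M \<sigma>)"
  have "(\<lambda>i. t $ i) \<in> simplex_product n M"
    using vertex_in_simplex_product[OF \<sigma>'] by (simp add: t_def simplex_product_def block_index_less)
  then have feasible: "RSQP_feasible n M t" by (simp add: RSQP_feasible_iff t_def)
  have "objective M H r t = ?f (vertex M \<sigma>)"
    using objective_eq_quad_fun[of t H M r] n by (auto simp: t_def intro: quad_fun_cong)
  then have "objective M H r t \<le> objective M H r s" if "RSQP_feasible n M s" for s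
    using that min objective_eq_quad_fun[of s H M r] n by (simp add: RSQP_feasible_iff)
  moreover have "l0_norm t = n" unfolding t_def using \<sigma>' by (rule l0_norm_vertex)
  ultimately show ?thesis
    \<comment> \<open>Feasibility for SQP2 implies that for RSQP, and \<open>t\<close> meets the
      sparsity bound with equality, so its minimality carries over to the smaller set.\<close>
    using feasible by (intro exI[of _ t]) (auto simp: is_arg_min_linorder SQP2_feasible_def)
qed

end
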